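(* Let $p$ and $q$ be relatively prime integers with $p\ge2$ and $q\ge2$. Define the integers $j$ and $k$ by $$[j]_p=[q]_p^{-1}\in\mathbb{Z}/p\mathbb{Z},\ \ 1\le j\le p-1,\qquad [k]_q=[-p]_q^{-1}\in\mathbb{Z}/q\mathbb{Z},\ \ 1\le k\le q-1.$$ Then the constituent knots of the torus theta-curve $\theta(p,q)$ are $$k_3=e_1-e_2=t(p,q),\qquad k_2=e_3-e_1=-t(j,k),\qquad k_1=e_2-e_3=-t(p-j,q-k).$$ In particular, the set of unoriented constituent knots of $\theta(p,q)$ is $\{t(p,q),\ t(j,k),\ t(p-j,q-k)\}$, where $1\le p-j\le p-1$ and $1\le q-k\le q-1$. Furthermore, the set of unoriented constituent knots of $\theta(p,-q)$ is $\{t(p,-q),\ t(j,-k),\ t(p-j,k-q)\}$, the set of unoriented constituent knots of $\theta(-p,-q)$ is $\{t(-p,-q),\ t(-j,-k),\ t(j-p,k-q)\}$, and the set of unoriented constituent knots of $\theta(-p,q)$ is $\{t(-p,q),\ t(-j,k),\ t(j-p,q-k)\}$, where $1-p\le -j\le -1$, $1-q\le -k\le -1$, $1-p\le j-p\le -1$, and $1-q\le k-q\le -1$.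
   Context: $[k]_n$ is the class of the integer $k$ in $\mathbb{Z}/n\mathbb{Z}$. The theta-graph has two vertices $v_1,v_2$ and three edges $e_1,e_2,e_3$, each oriented from $v_1$ to $v_2$; a theta-curve is an embedding of it in $S^3$. Its constituent knots are the oriented simple closed curves $k_1=e_2-e_3$, $k_2=e_3-e_1$, $k_3=e_1-e_2$ (traverse the first edge forward and then the second backward). For an oriented knot $K$, $-K$ is $K$ with reversed orientation. The curves $\theta(p,q)$. Let $T\subseteq S^3$ be the standard unknotted torus with oriented longitude $l$ and meridian $m$, identified with $\mathbb{R}^2/\mathbb{Z}^2$ so that $l$ is the image of $\mathbb{R}\times\{0\}$ and $m$ the image of $\{0\}\times\mathbb{R}$; concretely one may take $T=\{(z_1,z_2)\in S^3\subseteq\mathbb{C}^2:|z_1|=|z_2|\}$ with $(s,t)\mapsto \frac{1}{\sqrt2}(e^{2\pi i s},e^{2\pi i t})$. For relatively prime $p,q$, the torus knot $t(p,q)\subseteq T$ is the oriented image of the line $u\mapsto (up,uq)$ (it wraps $p$ times in the longitudinal and $q$ times in the meridional direction). Simple closed curves on $T$ are considered up to isotopy on $T$: an equality such as $k_2=-t(j,k)$ means that the two oriented curves are isotopic on $T$ (equivalently, as these are essential oriented simple closed curves, they represent the same class in $H_1(T)\cong\mathbb{Z}^2$ with ordered basis $[l,m]$, where $t(a,b)$ represents $(a,b)$). For relatively prime $p,q\ge2$, $\theta(p,q)$ is $t(p,q)\cup e_3$, where $v_1$ is the point $l\cap m=(0,0)\in t(p,q)$, $e_3$ is the arc of $m$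 starting at $v_1$ and following the orientation of $m$ until $t(p,q)$ is first met again, at $v_2$; $e_1$ is the arc of $t(p,q)$ from $v_1$ to $v_2$ following the orientation of $t(p,q)$, and $e_2$ is the remaining arc of $t(p,q)$, oriented from $v_1$ to $v_2$. Let $\rho$ be the orientation preserving involution of $S^3$ acting on $T$ by $(s,t)\mapsto(-s,-t)$ (in the model, $(z_1,z_2)\mapsto(\bar z_1,\bar z_2)$) and $R$ the reflection of $S^3$ acting on $T$ by $(s,t)\mapsto(s,-t)$ (in the model, $(z_1,z_2)\mapsto(z_1,\bar z_2)$). For $p,q\ge2$ relatively prime define $\theta(p,-q)=R(\theta(p,q))$, $\theta(-p,-q)=\rho(\theta(p,q))$, and $\theta(-p,q)=R(\theta(-p,-q))=\rho(\theta(p,-q))$. *)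

theory Defs
  imports "HOL-Analysis.Analysis" "HOL-Number_Theory.Cong"
begin

section \<open>Theta-curves and their constituent knots\<close>

text \<open>
  The three-sphere is the unit sphere of \<open>complex \<times> complex\<close>, whose library norm is the
  Euclidean norm of \<open>\<complex>\<^sup>2\<close>.  A theta-curve is given by the parametrized edges, each running from
  the first vertex to the second one.
\<close>

datatype 'a theta =
  Theta (edge1: "real \<Rightarrow> 'a") (edge2: "real \<Rightarrow> 'a") (edge3: "real \<Rightarrow> 'a")

definition is_theta_curve :: "(complex \<times> complex) theta \<Rightarrow> bool" where
  "is_theta_curve \<Theta> \<longleftrightarrow>
     (\<exists>v1 v2. v1 \<noteq> v2 \<and>
        (\<forall>e\<in>{edge1 \<Theta>, edge2 \<Theta>, edge3 \<Theta>}.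
           arc e \<and> path_image e \<subseteq> sphere 0 1 \<and> pathstart e = v1 \<and> pathfinish e = v2) \<and>
        path_image (edge1 \<Theta>) \<inter> path_image (edge2 \<Theta>) = {v1, v2} \<and>
        path_image (edge2 \<Theta>) \<inter> path_image (edge3 \<Theta>) = {v1, v2} \<and>
        path_image (edge3 \<Theta>) \<inter> path_image (edge1 \<Theta>) = {v1, v2})"

definition theta_image :: "('a \<Rightarrow> 'b) \<Rightarrow> 'a theta \<Rightarrow> 'b theta" where
  "theta_image f \<Theta> = Theta (f \<circ> edge1 \<Theta>) (f \<circ> edge2 \<Theta>) (f \<circ> edge3 \<Theta>)"

definition constituent1 :: "'a::topological_space theta \<Rightarrow> real \<Rightarrow> 'a" where
  "constituent1 \<Theta> = edge2 \<Theta> +++ reversepath (edge3 \<Theta>)"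

definition constituent2 :: "'a::topological_space theta \<Rightarrow> real \<Rightarrow> 'a" where
  "constituent2 \<Theta> = edge3 \<Theta> +++ reversepath (edge1 \<Theta>)"

definition constituent3 :: "'a::topological_space theta \<Rightarrow> real \<Rightarrow> 'a" where
  "constituent3 \<Theta> = edge1 \<Theta> +++ reversepath (edge2 \<Theta>)"


section \<open>Simple closed curves on a surface, up to isotopy\<close>

definition ambient_isotopy :: "'a::topological_space set \<Rightarrow> (real \<Rightarrow> 'a \<Rightarrow> 'a) \<Rightarrow> bool" where
  "ambient_isotopy S H \<longleftrightarrow>
     continuous_on ({0..1} \<times> S) (\<lambda>(s, x). H s x) \<and>
     (\<forall>s\<in>{0..1}. \<exists>g. homeomorphism S S (H s) g) \<and>
     (\<forall>x\<in>S. H 0 x = x)"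

text \<open>
  Two parametrizations of the same oriented closed curve: they differ by a change of base point
  and an increasing change of parameter.
\<close>

definition same_oriented_loop :: "(real \<Rightarrow> 'a::topological_space) \<Rightarrow> (real \<Rightarrow> 'a) \<Rightarrow> bool" where
  "same_oriented_loop c d \<longleftrightarrow>
     (\<exists>a\<in>{0..1}. \<exists>\<phi>. continuous_on {0..1} \<phi> \<and> strict_mono_on {0..1} \<phi> \<and> \<phi> 0 = 0 \<and> \<phi> 1 = 1 \<and>
        (\<forall>u\<in>{0..1}. d u = shiftpath a c (\<phi> u)))"

definition simple_loop_on :: "'a::topological_space set \<Rightarrow> (real \<Rightarrow> 'a) \<Rightarrow> bool" where
  "simple_loop_on S c \<longleftrightarrow> simple_path c \<and> pathfinish c = pathstart c \<and> path_image c \<subseteq> S"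

definition isotopic_loops :: "'a::topological_space set \<Rightarrow> (real \<Rightarrow> 'a) \<Rightarrow> (real \<Rightarrow> 'a) \<Rightarrow> bool" where
  "isotopic_loops S c d \<longleftrightarrow> simple_loop_on S c \<and> simple_loop_on S d \<and>
     (\<exists>H. ambient_isotopy S H \<and> same_oriented_loop (H 1 \<circ> c) d)"

text \<open>
  An unoriented simple closed curve is its underlying point set, hence the isotopy class of the
  unoriented curve is a class of subsets of the surface.
\<close>

definition isotopic_sets :: "'a::topological_space set \<Rightarrow> 'a set \<Rightarrow> 'a set \<Rightarrow> bool" where
  "isotopic_sets S C D \<longleftrightarrow> C \<subseteq> S \<and> D \<subseteq> S \<and> (\<exists>H. ambient_isotopy S H \<and> H 1 ` C = D)"

definition unoriented_class :: "'a::topological_space set \<Rightarrow> (real \<Rightarrow> 'a) \<Rightarrow> 'a set set" where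
  "unoriented_class S c = {D. isotopic_sets S (path_image c) D}"

definition unoriented_constituents :: "'a::topological_space set \<Rightarrow> 'a theta \<Rightarrow> 'a set set set" where
  "unoriented_constituents S \<Theta> =
     unoriented_class S ` {constituent1 \<Theta>, constituent2 \<Theta>, constituent3 \<Theta>}"


section \<open>Torus knots and torus theta-curves\<close>

definition torus :: "(complex \<times> complex) set" where
  "torus = {z \<in> sphere 0 1. cmod (fst z) = cmod (snd z)}"

definition torus_point :: "real \<Rightarrow> real \<Rightarrow> complex \<times> complex" where
  "torus_point s t = (1 / sqrt 2) *\<^sub>R (cis (2 * pi * s), cis (2 * pi * t))"

definition meridian :: "real \<Rightarrow> complex \<times> complex" where
  "meridian t = torus_point 0 t"

definition torus_knot :: "int \<Rightarrow> int \<Rightarrow> real \<Rightarrow> complex \<times> complex" where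
  "torus_knot p q u = torus_point (u * p) (u * q)"

text \<open>
  For coprime \<open>p, q \<ge> 2\<close>: the parameter at which the meridian, having left the first vertex
  \<open>torus_point 0 0\<close>, first meets the torus knot again, and the parameter of this
  intersection point (the second vertex) on the torus knot.
\<close>

definition meeting_meridian :: "int \<Rightarrow> int \<Rightarrow> real" where
  "meeting_meridian p q = (LEAST t. 0 < t \<and> meridian t \<in> path_image (torus_knot p q))"

definition meeting_knot :: "int \<Rightarrow> int \<Rightarrow> real" where
  "meeting_knot p q =
     (THE u. u \<in> {0<..<1} \<and> torus_knot p q u = meridian (meeting_meridian p q))"

definition pos_torus_theta :: "int \<Rightarrow> int \<Rightarrow> (complex \<times> complex) theta" where
  "pos_torus_theta p q =
     Theta (subpath 0 (meeting_knot p q) (torus_knot p q))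
           (reversepath (subpath (meeting_knot p q) 1 (torus_knot p q)))
           (subpath 0 (meeting_meridian p q) meridian)"

definition rho :: "complex \<times> complex \<Rightarrow> complex \<times> complex" where
  "rho z = (cnj (fst z), cnj (snd z))"

definition mirror :: "complex \<times> complex \<Rightarrow> complex \<times> complex" where
  "mirror z = (fst z, cnj (snd z))"

text \<open>
  Meaningful for coprime \<open>p, q\<close> of absolute value at least 2.  As \<open>mirror\<close> and \<open>rho\<close> commute,
  the last case (\<open>p < 0 < q\<close>) equals \<open>theta_image rho (torus_theta (- p) (- q))\<close>.
\<close>

definition torus_theta :: "int \<Rightarrow> int \<Rightarrow> (complex \<times> complex) theta" where
  "torus_theta p q =
     (if p > 0 \<and> q > 0 then pos_torus_theta p q
      else if p > 0 then theta_image mirror (pos_torus_theta p (- q))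
      else if q < 0 then theta_image rho (pos_torus_theta (- p) (- q))
      else theta_image mirror (theta_image rho (pos_torus_theta (- p) q)))"


section \<open>Torus theta-curves are theta-curves\<close>

lemma cis_2pi_eq_iff: "cis (2 * pi * x) = cis (2 * pi * y) \<longleftrightarrow> x - y \<in> \<int>"
proof
  assume "cis (2 * pi * x) = cis (2 * pi * y)"
  then have "cos (2*pi*x) = cos (2*pi*y) \<and> sin (2*pi*x) = sin (2*pi*y)"
    by (simp add: complex_eq_iff)
  then obtain n :: int where "2*pi*x = 2*pi*y + 2*pi*n"
    using sin_cos_eq_iff by blast
  then have "2 * pi * (x - y - n) = 0"
    by (simp add: algebra_simps)
  then have "x - y = n"
    by simp
  then show "x - y \<in> \<int>" by simp
next
  assume "x - y \<in> \<int>"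
  then have "cis (2 * pi * (x - y)) = 1" by (rule cis_multiple_2pi)
  then have "cis (2 * pi * x) / cis (2 * pi * y) = 1"
    by (simp add: cis_divide algebra_simps)
  then show "cis (2 * pi * x) = cis (2 * pi * y)" by simp
qed

lemma torus_point_eq_iff:
  "torus_point s t = torus_point s' t' \<longleftrightarrow> s - s' \<in> \<int> \<and> t - t' \<in> \<int>"
  by (simp add: torus_point_def cis_2pi_eq_iff)

lemma torus_knot_eq_iff:
  assumes "coprime p q"
  shows "torus_knot p q u = torus_knot p q v \<longleftrightarrow> u - v \<in> \<int>"
proof
  assume "torus_knot p q u = torus_knot p q v"
  then have 1: "(u - v) * p \<in> \<int>" "(u - v) * q \<in> \<int>"
    by (simp_all add: torus_knot_def torus_point_eq_iff left_diff_distrib)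
  obtain a b where "a * p + b * q = 1"
    using assms by (metis bezout_int coprime_imp_gcd_eq_1)
  then have "real_of_int a * p + real_of_int b * q = 1"
    by (metis of_int_1 of_int_add of_int_mult)
  then have "(u - v) * (a * p + b * q) = u - v"
    by simp
  then have "u - v = a * ((u - v) * p) + b * ((u - v) * q)"
    by (simp add: algebra_simps)
  moreover have "a * ((u - v) * p) + b * ((u - v) * q) \<in> \<int>"
    using 1 by (intro Ints_add Ints_mult[OF Ints_of_int])
  ultimately show "u - v \<in> \<int>" by simp
next
  assume "u - v \<in> \<int>"
  then have "(u - v) * p \<in> \<int>" "(u - v) * q \<in> \<int>" by auto
  then show "torus_knot p q u = torus_knot p q v"
    by (simp add: torus_knot_def torus_point_eq_iff left_diff_distrib)
qed

lemma continuous_on_torus_point: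
  assumes "continuous_on A f" "continuous_on A g"
  shows "continuous_on A (\<lambda>x. torus_point (f x) (g x))"
  unfolding torus_point_def cis_conv_exp by (intro continuous_intros assms)

lemma torus_point_in_sphere: "torus_point s t \<in> sphere 0 1"
  by (simp add: torus_point_def norm_Pair power_divide)

lemma torus_knot_meets_meridian:
  assumes "coprime p q" "p \<ge> 2"
  shows "meridian t \<in> path_image (torus_knot p q) \<longleftrightarrow> t * p \<in> \<int>"
proof
  assume "meridian t \<in> path_image (torus_knot p q)"
  then obtain u :: real where "- (u * p) \<in> \<int>" "t - u * q \<in> \<int>"
    by (auto simp: path_image_def meridian_def torus_knot_def torus_point_eq_iff)
  then have "(t - u * q) * p - (- (u * p)) * q \<in> \<int>"
    by (intro Ints_diff[OF Ints_mult Ints_mult] Ints_of_int)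
  then show "t * p \<in> \<int>" by (simp add: algebra_simps)
next
  assume "t * p \<in> \<int>"
  then obtain n where n: "t * p = of_int n" by (auto elim: Ints_cases)
  obtain a b where ab: "a * p + b * q = 1"
    using assms by (metis bezout_int coprime_imp_gcd_eq_1)
  define u where "u = frac (real_of_int (n * b) / p)"
  define c where "c = \<lfloor>real_of_int (n * b) / p\<rfloor>"
  have u: "u = real_of_int (n * b) / p - c" by (simp add: u_def c_def frac_def)
  have u01: "u \<in> {0..1}" unfolding u_def using frac_lt_1[of "real_of_int (n * b) / p"] by simp
  have "u * p = of_int (n * b - c * p)" using assms by (simp add: u field_simps)
  moreover have "t - u * q = of_int (n * a + c * q)"
  proof -
    have "of_int n = real_of_int (n * a * p + n * b * q)"
      using ab by (metis distrib_left mult.assoc mult.right_neutral)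
    then have "t * p = (of_int (n * a) + of_int (n * b) / p * q) * p"
      using n assms by (simp add: field_simps)
    then have "t = of_int (n * a) + of_int (n * b) / p * q" using assms by simp
    then show ?thesis by (simp add: u algebra_simps)
  qed
  ultimately have "u * p \<in> \<int>" "t - u * q \<in> \<int>" by (metis Ints_of_int)+
  then have "meridian t = torus_knot p q u"
    by (simp add: meridian_def torus_knot_def torus_point_eq_iff)
  with u01 show "meridian t \<in> path_image (torus_knot p q)" by (auto simp: path_image_def)
qed

lemma meeting_meridian_eq:
  assumes "coprime p q" "p \<ge> 2"
  shows "meeting_meridian p q = 1 / p"
  unfolding meeting_meridian_def
proof (rule Least_equality)
  show "0 < 1 / real_of_int p \<and> meridian (1 / p) \<in> path_image (torus_knot p q)"
    using assms by (simp add: torus_knot_meets_meridian)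
  fix t assume "0 < t \<and> meridian t \<in> path_image (torus_knot p q)"
  then obtain n :: int where "t > 0" "t * p = n"
    using assms by (auto simp: torus_knot_meets_meridian elim: Ints_cases)
  then have "real_of_int n > 0" using assms by (metis mult_pos_pos of_int_pos less_le_trans zero_less_numeral)
  then have "t * p \<ge> 1" using \<open>t * p = n\<close> by simp
  then show "1 / p \<le> t" using assms by (simp add: field_simps)
qed

lemma meeting_knot:
  assumes "coprime p q" "p \<ge> 2"
  shows "meeting_knot p q \<in> {0<..<1}"
    and "torus_knot p q (meeting_knot p q) = meridian (meeting_meridian p q)"
proof -
  let ?P = "\<lambda>u. u \<in> {0<..<1} \<and> torus_knot p q u = meridian (meeting_meridian p q)"
  have "meridian (meeting_meridian p q) \<in> path_image (torus_knot p q)"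
    using assms by (simp add: torus_knot_meets_meridian meeting_meridian_eq)
  then obtain u where u: "u \<in> {0..1}" "torus_knot p q u = meridian (meeting_meridian p q)"
    by (auto simp: path_image_def)
  have not_v1: "meridian (meeting_meridian p q) \<noteq> torus_knot p q (of_int i)" for i
  proof
    assume "meridian (meeting_meridian p q) = torus_knot p q i"
    then have "1 / real_of_int p \<in> \<int>"
      using assms Ints_add[of "1 / p - real_of_int i * q" "i * q"]
      by (simp add: meridian_def torus_knot_def torus_point_eq_iff meeting_meridian_eq)
    then obtain n :: int where "1 / real_of_int p = n" by (auto elim: Ints_cases)
    then have "real_of_int 1 = of_int (n * p)" using assms by (simp add: field_simps)
    then have "n * p = 1" by (metis of_int_eq_iff)
    then show False using assms by (metis one_le_numeral dvd_triv_right zdvd_imp_le zero_less_one not_le numeral_le_one_iff order_trans semiring_norm(69))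
  qed
  have "u \<noteq> 0" "u \<noteq> 1" using u(2) not_v1[of 0] not_v1[of 1] by auto
  then have Pu: "?P u" using u by auto
  moreover have "v = u" if "?P v" for v
  proof -
    have "v - u \<in> \<int>" using that u assms by (metis torus_knot_eq_iff)
    moreover have "\<bar>v - u\<bar> < 1" using that Pu by auto
    ultimately show ?thesis using Ints_nonzero_abs_less1 by fastforce
  qed
  ultimately have "?P (meeting_knot p q)"
    unfolding meeting_knot_def by (intro theI[of ?P])
  then show "meeting_knot p q \<in> {0<..<1}"
    "torus_knot p q (meeting_knot p q) = meridian (meeting_meridian p q)" by auto
qed

lemma is_theta_curve_pos_torus_theta:
  assumes cop: "coprime p q" and p: "p \<ge> 2"
  shows "is_theta_curve (pos_torus_theta p q)"
proof -
  define w where "w = meeting_knot p q"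
  define \<tau> where "\<tau> = 1 / real_of_int p"
  define v where "v = meridian \<tau>"
  let ?t = "torus_knot p q"
  have w: "0 < w" "w < 1" and tw: "?t w = v"
    using meeting_knot[OF assms] by (auto simp: w_def v_def \<tau>_def meeting_meridian_eq[OF assms])
  have tau: "0 < \<tau>" "\<tau> < 1" using p by (auto simp: \<tau>_def)
  have t_eq: "?t a = ?t b \<longleftrightarrow> a = b \<or> \<bar>a - b\<bar> = 1" if "a \<in> {0..1}" "b \<in> {0..1}" for a b
  proof -
    have "a - b \<in> \<int> \<longleftrightarrow> a = b \<or> \<bar>a - b\<bar> = 1"
    proof
      assume "a - b \<in> \<int>"
      then obtain n :: int where n: "a - b = n" by (auto elim: Ints_cases)
      then have "-1 \<le> real_of_int n" "real_of_int n \<le> 1" using that by auto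
      then have "n \<in> {-1, 0, 1}" by auto
      then show "a = b \<or> \<bar>a - b\<bar> = 1" using n by auto
    next
      assume "a = b \<or> \<bar>a - b\<bar> = 1"
      then have "a - b = of_int 0 \<or> a - b = of_int 1 \<or> a - b = of_int (-1)" by auto
      then show "a - b \<in> \<int>" by (metis Ints_of_int)
    qed
    then show ?thesis using torus_knot_eq_iff[OF cop] by simp
  qed
  have m_eq: "meridian a = meridian b \<longleftrightarrow> a = b" if "a \<in> {0..\<tau>}" "b \<in> {0..\<tau>}" for a b
  proof -
    have "a = b" if "a - b \<in> \<int>"
    proof -
      have "\<bar>a - b\<bar> < 1" using \<open>a \<in> _\<close> \<open>b \<in> _\<close> tau by auto
      then show ?thesis using Ints_nonzero_abs_less1[OF \<open>a - b \<in> \<int>\<close>] by fastforce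
    qed
    then show ?thesis by (auto simp: meridian_def torus_point_eq_iff)
  qed
  have t0: "?t 0 = meridian 0" "?t 1 = meridian 0"
    by (auto simp: torus_knot_def meridian_def torus_point_eq_iff)
  have path_t: "path ?t" and path_m: "path meridian"
    unfolding path_def torus_knot_def meridian_def
    by (intro continuous_on_torus_point continuous_intros)+
  have arcs: "arc (subpath 0 w ?t)" "arc (subpath w 1 ?t)" "arc (subpath 0 \<tau> meridian)"
    using w tau path_t path_m t_eq m_eq
    by (auto intro!: inj_onI simp: arc_subpath_eq closed_segment_eq_real_ivl)
  have e1: "path_image (subpath 0 w ?t) = ?t ` {0..w}"
    and e2: "path_image (subpath w 1 ?t) = ?t ` {w..1}"
    and e3: "path_image (subpath 0 \<tau> meridian) = meridian ` {0..\<tau>}"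
    using w tau by (auto simp: path_image_subpath)
  have v: "v \<noteq> meridian 0" using m_eq[of \<tau> 0] tau by (auto simp: v_def)
  have mem: "meridian 0 \<in> ?t ` {0..w}" "v \<in> ?t ` {0..w}" "meridian 0 \<in> ?t ` {w..1}" "v \<in> ?t ` {w..1}"
    using w t0 tw image_eqI[of "meridian 0" ?t 0 "{0..w}"] image_eqI[of v ?t w "{0..w}"]
      image_eqI[of "meridian 0" ?t 1 "{w..1}"] image_eqI[of v ?t w "{w..1}"] by simp_all
  have i12: "?t ` {0..w} \<inter> ?t ` {w..1} = {meridian 0, v}"
  proof
    show "?t ` {0..w} \<inter> ?t ` {w..1} \<subseteq> {meridian 0, v}"
    proof
      fix x assume "x \<in> ?t ` {0..w} \<inter> ?t ` {w..1}"
      then obtain a b where ab: "x = ?t a" "x = ?t b" "a \<in> {0..w}" "b \<in> {w..1}" by blast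
      then have "a = b \<or> \<bar>a - b\<bar> = 1" using t_eq[of a b] w by auto
      then have "a = w \<or> a = 0" using ab w by auto
      then show "x \<in> {meridian 0, v}" using ab t0 tw by auto
    qed
    show "{meridian 0, v} \<subseteq> ?t ` {0..w} \<inter> ?t ` {w..1}"
      using mem by simp
  qed
  have meet: "s = 0 \<or> s = \<tau>" if "s \<in> {0..\<tau>}" "meridian s \<in> ?t ` {0..1}" for s
  proof -
    have "s * p \<in> \<int>" using that torus_knot_meets_meridian[OF assms] by (simp add: path_image_def)
    then obtain n :: int where n: "s * p = n" by (auto elim: Ints_cases)
    have "0 \<le> s * p" "s * p \<le> 1" using that(1) p by (simp_all add: \<tau>_def field_simps)
    then have "0 \<le> real_of_int n" "real_of_int n \<le> 1" using n by auto
    then have "n = 0 \<or> n = 1" by auto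
    then show ?thesis using n p by (auto simp: \<tau>_def field_simps)
  qed
  have i13: "?t ` A \<inter> meridian ` {0..\<tau>} = {meridian 0, v}"
    if "A = {0..w} \<or> A = {w..1}" for A
  proof
    have "A \<subseteq> {0..1}" using that w by auto
    show "?t ` A \<inter> meridian ` {0..\<tau>} \<subseteq> {meridian 0, v}"
    proof
      fix x assume x: "x \<in> ?t ` A \<inter> meridian ` {0..\<tau>}"
      then obtain s where s: "s \<in> {0..\<tau>}" "x = meridian s" by blast
      moreover have "x \<in> ?t ` {0..1}" using x \<open>A \<subseteq> {0..1}\<close> by blast
      ultimately have "s = 0 \<or> s = \<tau>" using meet[of s] by simp
      then show "x \<in> {meridian 0, v}" using s by (auto simp: v_def)
    qed
    have "meridian 0 \<in> ?t ` A" "v \<in> ?t ` A"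
      using that mem by auto
    then show "{meridian 0, v} \<subseteq> ?t ` A \<inter> meridian ` {0..\<tau>}"
      using tau by (auto simp: v_def)
  qed
  have sph: "?t ` A \<subseteq> sphere 0 1" "meridian ` A \<subseteq> sphere 0 1" for A
    unfolding torus_knot_def meridian_def using torus_point_in_sphere by blast+
  have ends: "pathstart (subpath 0 w ?t) = meridian 0" "pathfinish (subpath 0 w ?t) = v"
    "pathstart (subpath w 1 ?t) = v" "pathfinish (subpath w 1 ?t) = meridian 0"
    "pathstart (subpath 0 \<tau> meridian) = meridian 0" "pathfinish (subpath 0 \<tau> meridian) = v"
    using t0 tw by (simp_all add: v_def)
  have ints: "?t ` {0..w} \<inter> ?t ` {w..1} = {meridian 0, v}"
    "?t ` {w..1} \<inter> meridian ` {0..\<tau>} = {meridian 0, v}"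
    "meridian ` {0..\<tau>} \<inter> ?t ` {0..w} = {meridian 0, v}"
    using i12 i13[of "{w..1}"] i13[of "{0..w}"] by (simp_all add: Int_commute)
  show ?thesis
    unfolding is_theta_curve_def pos_torus_theta_def meeting_meridian_eq[OF assms]
      w_def[symmetric] \<tau>_def[symmetric] theta.sel ball_simps path_image_reversepath
      pathstart_reversepath pathfinish_reversepath arc_reversepath e1 e2 e3 ends
    using v arcs sph ints
    by (intro exI[of _ "meridian 0"] exI[of _ v]) (simp add: arc_reversepath)
qed

lemma is_theta_curve_theta_image:
  assumes "is_theta_curve \<Theta>" and f: "continuous_on UNIV f" "inj f" "f ` sphere 0 1 \<subseteq> sphere 0 1"
  shows "is_theta_curve (theta_image f \<Theta>)"
proof -
  have arc: "arc (f \<circ> e)" if "arc e" for e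
    using that f unfolding arc_def
    by (metis comp_inj_on continuous_on_subset path_continuous_image inj_on_subset subset_UNIV)
  have img: "path_image (f \<circ> e) = f ` path_image e" for e :: "real \<Rightarrow> complex \<times> complex"
    by (rule path_image_compose)
  obtain v1 v2 where v: "v1 \<noteq> v2"
    and e: "\<forall>e\<in>{edge1 \<Theta>, edge2 \<Theta>, edge3 \<Theta>}.
       arc e \<and> path_image e \<subseteq> sphere 0 1 \<and> pathstart e = v1 \<and> pathfinish e = v2"
    and i: "path_image (edge1 \<Theta>) \<inter> path_image (edge2 \<Theta>) = {v1, v2}"
    "path_image (edge2 \<Theta>) \<inter> path_image (edge3 \<Theta>) = {v1, v2}"
    "path_image (edge3 \<Theta>) \<inter> path_image (edge1 \<Theta>) = {v1, v2}"
    using assms(1) unfolding is_theta_curve_def by blast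
  have "f v1 \<noteq> f v2" using v f(2) by (simp add: inj_eq)
  moreover have "arc (f \<circ> e) \<and> path_image (f \<circ> e) \<subseteq> sphere 0 1 \<and>
      pathstart (f \<circ> e) = f v1 \<and> pathfinish (f \<circ> e) = f v2"
    if "e \<in> {edge1 \<Theta>, edge2 \<Theta>, edge3 \<Theta>}" for e
  proof -
    have *: "arc e" "path_image e \<subseteq> sphere 0 1" "pathstart e = v1" "pathfinish e = v2"
      using e that by blast+
    have "f ` path_image e \<subseteq> sphere 0 1" using *(2) f(3) by blast
    then show ?thesis using * arc by (simp add: img pathstart_compose pathfinish_compose)
  qed
  moreover have "f ` A \<inter> f ` B = {f v1, f v2}" if "A \<inter> B = {v1, v2}" for A B
    using image_Int[OF f(2), of A B] that by simp
  ultimately show ?thesis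
    unfolding is_theta_curve_def theta_image_def theta.sel img
    using i by (intro exI[of _ "f v1"] exI[of _ "f v2"]) (simp add: img)
qed

lemma is_theta_curve_torus_theta:
  assumes "coprime p q" "\<bar>p\<bar> \<ge> 2" "\<bar>q\<bar> \<ge> 2"
  shows "is_theta_curve (torus_theta p q)"
proof -
  have r: "continuous_on UNIV mirror" "inj mirror" "mirror ` sphere 0 1 \<subseteq> sphere 0 1"
    by (auto simp: mirror_def[abs_def] norm_prod_def inj_def prod_eq_iff intro!: continuous_intros)
  have o: "continuous_on UNIV rho" "inj rho" "rho ` sphere 0 1 \<subseteq> sphere 0 1"
    by (auto simp: rho_def[abs_def] norm_prod_def inj_def prod_eq_iff intro!: continuous_intros)
  have "coprime \<bar>p\<bar> q" "coprime \<bar>p\<bar> (- q)" using assms by auto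
  then have "is_theta_curve (pos_torus_theta \<bar>p\<bar> q)" "is_theta_curve (pos_torus_theta \<bar>p\<bar> (- q))"
    using assms by (simp_all add: is_theta_curve_pos_torus_theta)
  then show ?thesis
    using assms(2,3)
    by (cases "p > 0"; cases "q > 0")
      (simp_all add: torus_theta_def is_theta_curve_theta_image r o)
qed

end

theory Submission
  imports Defs
begin

text \<open>
  Since \<open>j * q - k * p = 1\<close>, the second vertex is the point of parameter \<open>j / p\<close> on the torus knot.
  In the universal cover each constituent is therefore a path of two segments joining the origin
  to \<open>(p, q)\<close>, \<open>- (j, k)\<close> or \<open>- (p - j, q - k)\<close>, any two of which form a basis of the lattice.
  Completing the endpoint \<open>(a, b)\<close> to a basis by \<open>(c, d)\<close>, one of the other two up to sign, the path
  is transverse to the lines of direction \<open>(c, d)\<close>, that is, a graph over the line of direction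
  \<open>(a, b)\<close>; shearing along \<open>(c, d)\<close> is an ambient isotopy of the torus straightening it.
\<close>

section \<open>Isotopy of subsets of a compact surface\<close>

lemma ambient_isotopy_compose:
  assumes H: "ambient_isotopy S H" and K: "ambient_isotopy S K"
  shows "ambient_isotopy S (\<lambda>s. K s \<circ> H s)"
  unfolding ambient_isotopy_def
proof (intro conjI ballI)
  have img: "H s x \<in> S" if "s \<in> {0..1}" "x \<in> S" for s x
    using H that unfolding ambient_isotopy_def homeomorphism_def by blast
  have "continuous_on ({0..1} \<times> S) (\<lambda>z. (fst z, (\<lambda>(s, x). H s x) z))"
    using H by (intro continuous_intros) (auto simp: ambient_isotopy_def)
  then have "continuous_on ({0..1} \<times> S) ((\<lambda>(s, x). K s x) \<circ> (\<lambda>z. (fst z, (\<lambda>(s, x). H s x) z)))"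
    by (rule continuous_on_compose)
      (rule continuous_on_subset[of "{0..1} \<times> S"], use K img in \<open>auto simp: ambient_isotopy_def\<close>)
  then show "continuous_on ({0..1} \<times> S) (\<lambda>(s, x). (K s \<circ> H s) x)"
    by (simp add: o_def case_prod_beta)
next
  fix s :: real assume "s \<in> {0..1}"
  then obtain g h where "homeomorphism S S (H s) g" "homeomorphism S S (K s) h"
    using H K unfolding ambient_isotopy_def by blast
  then show "\<exists>g. homeomorphism S S (K s \<circ> H s) g"
    using homeomorphism_compose by blast
next
  fix x assume "x \<in> S"
  then show "(K 0 \<circ> H 0) x = x"
    using H K by (simp add: ambient_isotopy_def)
qed

text \<open>
  Continuity of the inverse isotopy: \<open>(s, x) \<mapsto> (s, H s x)\<close> is a continuous bijection of the
  compact space \<open>{0..1} \<times> S\<close> onto itself.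
\<close>

lemma ambient_isotopy_inverse:
  fixes S :: "'a::t2_space set"
  assumes H: "ambient_isotopy S H" and S: "compact S"
  obtains K where "ambient_isotopy S K"
    and "\<And>s x. s \<in> {0..1} \<Longrightarrow> x \<in> S \<Longrightarrow> K s (H s x) = x"
proof -
  obtain K where K: "\<And>s. s \<in> {0..1} \<Longrightarrow> homeomorphism S S (H s) (K s)"
    using H unfolding ambient_isotopy_def by metis
  have KH: "K s (H s x) = x" and HK: "H s (K s x) = x"
    and HS: "H s x \<in> S" and KS: "K s x \<in> S"
    if "s \<in> {0..1}" "x \<in> S" for s x
    using K[OF that(1)] that(2) unfolding homeomorphism_def by blast+
  define F where "F = (\<lambda>z. (fst z, (\<lambda>(s, x). H s x) z))"
  define G where "G = (\<lambda>z. (fst z, (\<lambda>(s, x). K s x) z))"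
  have "continuous_on ({0..1} \<times> S) F"
    using H unfolding F_def by (intro continuous_intros) (auto simp: ambient_isotopy_def)
  moreover have "compact ({0..1::real} \<times> S)"
    using S by (intro compact_Times) auto
  ultimately have "continuous_on (F ` ({0..1} \<times> S)) G"
    by (rule continuous_on_inv) (auto simp: F_def G_def KH)
  moreover have "F ` ({0..1} \<times> S) = {0..1} \<times> S"
  proof
    show "F ` ({0..1} \<times> S) \<subseteq> {0..1} \<times> S" by (auto simp: F_def HS)
    show "{0..1} \<times> S \<subseteq> F ` ({0..1} \<times> S)"
    proof
      fix z :: "real \<times> 'a" assume "z \<in> {0..1} \<times> S"
      then have "F (G z) = z" "G z \<in> {0..1} \<times> S"
        by (auto simp: F_def G_def HK KS)
      then show "z \<in> F ` ({0..1} \<times> S)" by (metis imageI)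
    qed
  qed
  ultimately have "continuous_on ({0..1} \<times> S) (\<lambda>z :: real \<times> 'a. snd (G z))"
    by (intro continuous_on_snd) simp
  then have "continuous_on ({0..1} \<times> S) (\<lambda>(s, x). K s x)"
    by (simp add: G_def)
  moreover have "\<exists>g. homeomorphism S S (K s) g" if "s \<in> {0..1}" for s
    using K[OF that] homeomorphism_symD by blast
  moreover have "K 0 x = x" if "x \<in> S" for x
    using KH[of 0 x] H that by (simp add: ambient_isotopy_def)
  ultimately have "ambient_isotopy S K"
    by (simp add: ambient_isotopy_def)
  then show ?thesis using KH that by blast
qed

lemma isotopic_sets_sym:
  fixes S :: "'a::t2_space set"
  assumes "isotopic_sets S C D" and "compact S"
  shows "isotopic_sets S D C"
proof -
  obtain H where H: "ambient_isotopy S H" "H 1 ` C = D" and CD: "C \<subseteq> S" "D \<subseteq> S"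
    using assms(1) unfolding isotopic_sets_def by blast
  obtain K where K: "ambient_isotopy S K"
    and inv: "\<And>s x. s \<in> {0..1} \<Longrightarrow> x \<in> S \<Longrightarrow> K s (H s x) = x"
    using ambient_isotopy_inverse[OF H(1) assms(2)] by blast
  have "K 1 ` D = (\<lambda>x. K 1 (H 1 x)) ` C"
    by (simp add: image_image flip: H(2))
  also have "\<dots> = (\<lambda>x. x) ` C"
    using CD(1) inv by (intro image_cong) auto
  finally show ?thesis
    using K CD by (auto simp: isotopic_sets_def)
qed

lemma isotopic_sets_trans:
  assumes "isotopic_sets S A B" and "isotopic_sets S B C"
  shows "isotopic_sets S A C"
proof -
  obtain H K where H: "ambient_isotopy S H" "H 1 ` A = B" and K: "ambient_isotopy S K" "K 1 ` B = C"
    using assms unfolding isotopic_sets_def by blast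
  have "(K 1 \<circ> H 1) ` A = C" using H(2) K(2) by (simp only: image_comp[symmetric])
  moreover have "A \<subseteq> S" "C \<subseteq> S"
    using assms by (simp_all add: isotopic_sets_def)
  ultimately show ?thesis
    using ambient_isotopy_compose[OF H(1) K(1)] unfolding isotopic_sets_def
    by (intro conjI exI[of _ "\<lambda>s. K s \<circ> H s"])
qed

text \<open>A class collects all sets isotopic to the given one, so equality of two classes takes
  both transitivity and symmetry; compactness enters through the latter.\<close>

lemma unoriented_class_eqI:
  fixes S :: "'a::t2_space set"
  assumes "isotopic_sets S (path_image c) (path_image d)" and "compact S"
  shows "unoriented_class S c = unoriented_class S d"
  unfolding unoriented_class_def
  using isotopic_sets_trans[OF assms(1)] isotopic_sets_trans[OF isotopic_sets_sym[OF assms]]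
  by (intro Collect_cong) blast

text \<open>The conjugated family \<open>f \<circ> H s \<circ> f\<close> starts at the identity
  because \<open>f\<close> is its own inverse on \<open>S\<close>. The map \<open>f\<close> may
  reverse the orientation of the surface, as \<open>mirror\<close> does.\<close>

lemma isotopic_sets_involution:
  assumes CD: "isotopic_sets S C D"
    and f: "continuous_on S f" "\<And>x. x \<in> S \<Longrightarrow> f x \<in> S" "\<And>x. x \<in> S \<Longrightarrow> f (f x) = x"
  shows "isotopic_sets S (f ` C) (f ` D)"
proof -
  obtain H where H: "ambient_isotopy S H" "H 1 ` C = D" and sub: "C \<subseteq> S" "D \<subseteq> S"
    using CD unfolding isotopic_sets_def by blast
  have img: "H s x \<in> S" if "s \<in> {0..1}" "x \<in> S" for s x
    using H(1) that unfolding ambient_isotopy_def homeomorphism_def by blast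
  have ff: "homeomorphism S S f f"
    using f by (intro homeomorphismI) auto
  have "ambient_isotopy S (\<lambda>s. f \<circ> H s \<circ> f)"
    unfolding ambient_isotopy_def
  proof (intro conjI ballI)
    have "continuous_on ({0..1::real} \<times> S) (\<lambda>z. f (snd z))"
      by (rule continuous_on_compose2[OF f(1)]) (auto intro!: continuous_intros)
    then have pair: "continuous_on ({0..1::real} \<times> S) (\<lambda>z. (fst z, f (snd z)))"
      by (intro continuous_on_Pair continuous_on_fst continuous_on_id)
    have "continuous_on ({0..1} \<times> S) (\<lambda>(s, x). H s x)"
      using H(1) by (simp add: ambient_isotopy_def)
    then have "continuous_on ({0..1} \<times> S) (\<lambda>z. (\<lambda>(s, x). H s x) (fst z, f (snd z)))"
      by (rule continuous_on_compose2[OF _ pair]) (auto simp: f(2))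
    then have "continuous_on ({0..1} \<times> S) (\<lambda>z. f ((\<lambda>(s, x). H s x) (fst z, f (snd z))))"
      by (rule continuous_on_compose2[OF f(1)]) (auto simp: img f(2))
    then show "continuous_on ({0..1} \<times> S) (\<lambda>(s, x). (f \<circ> H s \<circ> f) x)"
      by (simp add: o_def case_prod_beta)
  next
    fix s :: real assume "s \<in> {0..1}"
    then obtain g where "homeomorphism S S (H s) g"
      using H(1) unfolding ambient_isotopy_def by blast
    then show "\<exists>g. homeomorphism S S (f \<circ> H s \<circ> f) g"
      using homeomorphism_compose[OF ff homeomorphism_compose[OF _ ff]] by (auto simp: o_assoc)
  next
    fix x assume "x \<in> S"
    then show "(f \<circ> H 0 \<circ> f) x = x"
      using H(1) f by (simp add: ambient_isotopy_def)
  qed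
  moreover have "(f \<circ> H 1 \<circ> f) ` (f ` C) = f ` D"
  proof -
    have "(f \<circ> H 1 \<circ> f) ` (f ` C) = (\<lambda>x. f (H 1 (f (f x)))) ` C"
      by (simp add: image_image)
    also have "\<dots> = (\<lambda>x. f (H 1 x)) ` C"
      using sub f(3) by (intro image_cong) auto
    also have "\<dots> = f ` D"
      by (simp add: image_image flip: H(2))
    finally show ?thesis .
  qed
  moreover have "f ` C \<subseteq> S" "f ` D \<subseteq> S" using sub f(2) by auto
  ultimately show ?thesis unfolding isotopic_sets_def
    by (intro conjI exI[of _ "\<lambda>s. f \<circ> H s \<circ> f"])
qed

section \<open>Reparametrization, and passage from oriented loops to point sets\<close>

lemma strict_mono_on_image_unit_interval:
  fixes \<phi> :: "real \<Rightarrow> real"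
  assumes "continuous_on {0..1} \<phi>" and "strict_mono_on {0..1} \<phi>" and "\<phi> 0 = 0" "\<phi> 1 = 1"
  shows "\<phi> ` {0..1} = {0..1}"
proof
  have "\<phi> 0 \<le> \<phi> u \<and> \<phi> u \<le> \<phi> 1" if "u \<in> {0..1}" for u
    using that strict_mono_on_leD[OF assms(2), of 0 u] strict_mono_on_leD[OF assms(2), of u 1] by simp
  then show "\<phi> ` {0..1} \<subseteq> {0..1}" using assms(3,4) by auto
  show "{0..1} \<subseteq> \<phi> ` {0..1}"
    using IVT'[of \<phi> 0 _ 1] assms by fastforce
qed

text \<open>The change of parameter is onto \<open>{0..1}\<close>, and a closed path keeps its
  points when its base point moves.\<close>

lemma path_image_same_oriented_loop:
  assumes "same_oriented_loop c d" and "pathfinish c = pathstart c"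
  shows "path_image d = path_image c"
proof -
  obtain a \<phi> where a: "a \<in> {0..1}" and \<phi>: "continuous_on {0..1} \<phi>" "strict_mono_on {0..1} \<phi>"
      "\<phi> 0 = 0" "\<phi> 1 = (1::real)"
    and d: "\<forall>u\<in>{0..1}. d u = shiftpath a c (\<phi> u)"
    using assms(1) unfolding same_oriented_loop_def by blast
  have "\<phi> ` {0..1} = {0..1}" using \<phi> by (rule strict_mono_on_image_unit_interval)
  then have "path_image (shiftpath a c) = shiftpath a c ` (\<phi> ` {0..1})"
    by (simp add: path_image_def)
  also have "\<dots> = path_image d"
    using d by (simp add: path_image_def image_image)
  finally show ?thesis
    using path_image_shiftpath[OF a assms(2)] by simp
qed

lemma isotopic_loops_imp_isotopic_sets:
  assumes "isotopic_loops S c d"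
  shows "isotopic_sets S (path_image c) (path_image d)"
proof -
  obtain H where "ambient_isotopy S H" and H: "same_oriented_loop (H 1 \<circ> c) d"
    and c: "simple_loop_on S c" and d: "simple_loop_on S d"
    using assms unfolding isotopic_loops_def by blast
  moreover have "H 1 ` path_image c = path_image d"
    using path_image_same_oriented_loop[OF H] c
    by (simp add: simple_loop_on_def path_image_compose pathstart_compose pathfinish_compose)
  ultimately show ?thesis
    unfolding isotopic_sets_def simple_loop_on_def by (intro conjI exI[of _ H]) simp_all
qed


section \<open>Shears of the torus\<close>

lemma torus_point_in_torus: "torus_point s t \<in> torus"
  using torus_point_in_sphere[of s t] by (simp add: torus_def torus_point_def)

text \<open>Both coordinates have modulus \<open>1 / sqrt 2\<close>, so their arguments divided by
  \<open>2 * pi\<close> serve as parameters.\<close>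

lemma torusE:
  assumes "z \<in> torus"
  obtains s t where "z = torus_point s t"
proof -
  have eq: "cmod (fst z) = cmod (snd z)" "(cmod (fst z))\<^sup>2 + (cmod (snd z))\<^sup>2 = 1"
    using assms by (auto simp: torus_def norm_prod_def)
  then have "(cmod (fst z))\<^sup>2 = (1 / sqrt 2)\<^sup>2" by (simp add: power_divide)
  then have n: "cmod (fst z) = 1 / sqrt 2" "cmod (snd z) = 1 / sqrt 2"
    using eq(1) power2_eq_imp_eq[of "cmod (fst z)" "1 / sqrt 2"] by simp_all
  have *: "w = (1 / sqrt 2) *\<^sub>R cis (2 * pi * (Arg2pi w / (2 * pi)))" if "cmod w = 1 / sqrt 2" for w
    using Arg2pi_eq[of w] that by (simp add: cis_conv_exp scaleR_conv_of_real)
  show ?thesis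
    using *[OF n(1)] *[OF n(2)]
    by (intro that[of "Arg2pi (fst z) / (2 * pi)" "Arg2pi (snd z) / (2 * pi)"])
      (simp add: torus_point_def prod_eq_iff)
qed

lemma compact_torus: "compact torus"
proof -
  have "torus = sphere 0 1 \<inter> {z. cmod (fst z) = cmod (snd z)}"
    by (auto simp: torus_def)
  moreover have "closed {z :: complex \<times> complex. cmod (fst z) = cmod (snd z)}"
    by (intro closed_Collect_eq continuous_intros)
  ultimately show ?thesis by (metis compact_Int_closed compact_sphere)
qed

text \<open>
  The character of the torus that is constant on the translates of \<open>torus_knot c d\<close>.
\<close>

definition torus_char :: "int \<Rightarrow> int \<Rightarrow> complex \<times> complex \<Rightarrow> complex" where
  "torus_char c d z = (sqrt 2 *\<^sub>R fst z) powi d * (sqrt 2 *\<^sub>R snd z) powi (- c)"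

text \<open>Each point slides backwards in the direction \<open>(c, d)\<close>, by an amount
  depending only on its character value. Rotating the two complex coordinates avoids any choice of
  angles for the point.\<close>

definition torus_shear ::
    "int \<Rightarrow> int \<Rightarrow> (complex \<Rightarrow> real) \<Rightarrow> real \<Rightarrow> complex \<times> complex \<Rightarrow> complex \<times> complex" where
  "torus_shear c d g s z =
     (let r = s * g (torus_char c d z)
      in (fst z * cis (- (2 * pi * (r * c))), snd z * cis (- (2 * pi * (r * d)))))"

lemma torus_char_torus_point: "torus_char c d (torus_point s t) = cis (2 * pi * (d * s - c * t))"
  by (simp add: torus_char_def torus_point_def cis_power_int cis_mult algebra_simps
      del: power_int_minus)

lemma torus_shear_torus_point:
  "torus_shear c d g s (torus_point x y) =
     (let r = s * g (cis (2 * pi * (d * x - c * y))) in torus_point (x - r * c) (y - r * d))"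
  by (simp add: torus_shear_def torus_char_torus_point Let_def)
    (simp add: torus_point_def cis_mult algebra_simps)

lemma torus_shear_in_torus: "z \<in> torus \<Longrightarrow> torus_shear c d g s z \<in> torus"
  by (elim torusE) (simp add: torus_shear_torus_point Let_def torus_point_in_torus)

text \<open>Moving in the direction \<open>(c, d)\<close> leaves \<open>d * x - c * y\<close>
  unchanged, so the way back uses the same multiple \<open>r\<close>.\<close>

lemma torus_shear_inverse:
  assumes "z \<in> torus"
  shows "torus_shear c d g (- s) (torus_shear c d g s z) = z"
proof -
  obtain x y where z: "z = torus_point x y" using assms by (rule torusE)
  define r where "r = s * g (cis (2 * pi * (d * x - c * y)))"
  have "d * (x - r * c) - c * (y - r * d) = d * x - c * y" by (simp add: algebra_simps)
  then show ?thesis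
    by (simp add: z torus_shear_torus_point Let_def flip: r_def)
qed

lemma torus_char_in_circle: "z \<in> torus \<Longrightarrow> torus_char c d z \<in> sphere 0 1"
  by (elim torusE) (simp add: torus_char_torus_point)

lemma continuous_on_torus_char: "continuous_on torus (torus_char c d)"
proof -
  \<comment> \<open>The exponents of the character may be negative, so the coordinates must not
    vanish.\<close>
  have "sqrt 2 *\<^sub>R fst z \<noteq> 0 \<and> sqrt 2 *\<^sub>R snd z \<noteq> 0" if "z \<in> torus" for z
    using that by (elim torusE) (simp add: torus_point_def)
  then show ?thesis
    unfolding torus_char_def[abs_def] by (intro continuous_intros) auto
qed

lemma ambient_isotopy_torus_shear:
  assumes g: "continuous_on (sphere 0 1) g"
  shows "ambient_isotopy torus (torus_shear c d g)"
proof -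
  have "continuous_on torus (\<lambda>z. g (torus_char c d z))"
    by (rule continuous_on_compose2[OF g continuous_on_torus_char]) (use torus_char_in_circle in blast)
  \<comment> \<open>The set \<open>A\<close> of times is arbitrary because the shear at time
    \<open>s\<close> is inverted by the one at time \<open>- s\<close>, outside
    \<open>{0..1}\<close> when \<open>s\<close> is positive.\<close>
  then have G: "continuous_on (A \<times> torus) (\<lambda>z. g (torus_char c d (snd z)))" for A :: "real set"
    by (rule continuous_on_compose2) (auto intro!: continuous_intros)
  have joint: "continuous_on (A \<times> torus) (\<lambda>(s, z). torus_shear c d g s z)" for A
    unfolding torus_shear_def Let_def case_prod_beta by (intro continuous_intros G)
  have cont: "continuous_on torus (torus_shear c d g s)" for s
  proof -
    have "continuous_on torus (\<lambda>z. (\<lambda>(s, z). torus_shear c d g s z) (s, z))"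
      by (rule continuous_on_compose2[OF joint[of UNIV]]) (auto intro!: continuous_intros)
    then show ?thesis by simp
  qed
  have "homeomorphism torus torus (torus_shear c d g s) (torus_shear c d g (- s))" for s
    using torus_shear_inverse[of _ c d g s] torus_shear_inverse[of _ c d g "- s"]
    by (intro homeomorphismI cont) (auto simp: torus_shear_in_torus)
  then show ?thesis
    using joint[of "{0..1}"] by (auto simp: ambient_isotopy_def torus_shear_def)
qed

lemma loop_descends_to_circle:
  fixes h :: "real \<Rightarrow> 'a::real_normed_vector"
  assumes "continuous_on {0..1} h" and "h 0 = h 1"
  obtains g where "continuous_on (sphere 0 1) g"
    and "\<And>s. s \<in> {0..1} \<Longrightarrow> g (cis (2 * pi * s)) = h s"
proof
  let ?g = "h \<circ> (\<lambda>z. Arg2pi z / (2 * pi))"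
  \<comment> \<open>Homotopic loops induce homotopic maps of the circle. Applied to \<open>h\<close>
    and itself, this gives continuity of the induced map, also at the point 1, where
    \<open>Arg2pi\<close> jumps.\<close>
  have "homotopic_loops UNIV h h"
    using assms by (simp add: homotopic_loops_refl path_def pathstart_def pathfinish_def)
  then show "continuous_on (sphere 0 1) ?g"
    using homotopic_loops_imp_homotopic_circlemaps homotopic_with_imp_continuous by blast
  fix s :: real assume s: "s \<in> {0..1}"
  \<comment> \<open>\<open>Arg2pi\<close> stays below \<open>2 * pi\<close>, so the parameter 1 is
    read as 0, and \<open>h 0 = h 1\<close> is needed there.\<close>
  show "?g (cis (2 * pi * s)) = h s"
  proof (cases "s = 1")
    case True
    have "Arg2pi 1 = 0" by (rule Arg2pi_unique[of 1]) auto
    then show ?thesis using True assms(2) by simp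
  next
    case False
    then have "Arg2pi (cis (2 * pi * s)) = 2 * pi * s"
      using s by (intro Arg2pi_unique[of 1]) (auto simp: cis_conv_exp)
    then show ?thesis by simp
  qed
qed


section \<open>Loops transverse to a linear foliation\<close>

text \<open>The height \<open>d * x u - c * y u\<close> lifts the character along the path and
  increases strictly from 0 to 1. Coinciding points have heights that differ by an integer, so only
  the two ends can coincide.\<close>

lemma simple_loop_on_torus_transverse:
  fixes a b c d :: int and x y :: "real \<Rightarrow> real"
  assumes det: "a * d - b * c = 1"
    and cont: "continuous_on {0..1} x" "continuous_on {0..1} y"
    and ends: "x 0 = 0" "y 0 = 0" "x 1 = a" "y 1 = b"
    and mono: "strict_mono_on {0..1} (\<lambda>u. d * x u - c * y u)"
  shows "simple_loop_on torus (\<lambda>u. torus_point (x u) (y u))"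
proof -
  define \<sigma> where "\<sigma> u = d * x u - c * y u" for u
  have ends': "\<sigma> 0 = 0" "\<sigma> 1 = 1"
    using ends det by (simp_all add: \<sigma>_def algebra_simps flip: of_int_mult of_int_diff)
  have mono': "\<sigma> u < \<sigma> v" if "u \<in> {0..1}" "v \<in> {0..1}" "u < v" for u v
    using mono that unfolding \<sigma>_def strict_mono_on_def by blast
  have "u = v \<or> u = 0 \<and> v = 1 \<or> u = 1 \<and> v = 0"
    if uv: "u \<in> {0..1}" "v \<in> {0..1}" and eq: "torus_point (x u) (y u) = torus_point (x v) (y v)" for u v
  proof -
    have in01: "\<sigma> u \<in> {0..1}" "\<sigma> v \<in> {0..1}"
      "u \<noteq> 0 \<Longrightarrow> \<sigma> u > 0" "u \<noteq> 1 \<Longrightarrow> \<sigma> u < 1" "v \<noteq> 0 \<Longrightarrow> \<sigma> v > 0" "v \<noteq> 1 \<Longrightarrow> \<sigma> v < 1"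
      using mono'[of 0 u] mono'[of u 1] mono'[of 0 v] mono'[of v 1] uv ends'
      by (cases "u = 0"; cases "u = 1"; cases "v = 0"; cases "v = 1"; force)+
    have "d * (x u - x v) - c * (y u - y v) \<in> \<int>"
      using eq by (intro Ints_diff[OF Ints_mult Ints_mult]) (auto simp: torus_point_eq_iff)
    then have int: "\<sigma> u - \<sigma> v \<in> \<int>" by (simp add: \<sigma>_def algebra_simps)
    \<comment> \<open>A nonzero integer difference of two heights in \<open>{0..1}\<close> forces
      these to be 0 and 1, attained only at the ends.\<close>
    show ?thesis
    proof (cases "\<bar>\<sigma> u - \<sigma> v\<bar> < 1")
      case True
      then have "\<sigma> u = \<sigma> v" using Ints_nonzero_abs_less1[OF int] by fastforce
      then show ?thesis using mono'[of u v] mono'[of v u] uv by (cases u v rule: linorder_cases) auto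
    next
      case False
      then show ?thesis using in01 by (cases "u = 0"; cases "u = 1"; cases "v = 0"; cases "v = 1") auto
    qed
  qed
  then have "loop_free (\<lambda>u. torus_point (x u) (y u))" unfolding loop_free_def by blast
  moreover have "path (\<lambda>u. torus_point (x u) (y u))"
    unfolding path_def by (intro continuous_on_torus_point cont)
  ultimately show ?thesis
    using ends by (auto simp: simple_loop_on_def simple_path_def pathstart_def pathfinish_def
        path_image_def torus_point_eq_iff torus_point_in_torus)
qed

text \<open>
  In the coordinates \<open>(d * s - c * t, a * t - b * s)\<close> the loop is a graph over the first one,
  and a shear in the second one flattens it.
\<close>

lemma isotopic_loops_torus_transverse:
  fixes a b c d :: int and x y :: "real \<Rightarrow> real"
  assumes det: "a * d - b * c = 1"
    and cont: "continuous_on {0..1} x" "continuous_on {0..1} y"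
    and ends: "x 0 = 0" "y 0 = 0" "x 1 = a" "y 1 = b"
    and mono: "strict_mono_on {0..1} (\<lambda>u. d * x u - c * y u)"
  shows "isotopic_loops torus (\<lambda>u. torus_point (x u) (y u)) (torus_knot a b)"
proof -
  define \<sigma> where "\<sigma> u = d * x u - c * y u" for u
  have det': "real_of_int a * d - b * c = 1"
    using det by (metis of_int_1 of_int_diff of_int_mult)
  have ends': "\<sigma> 0 = 0" "\<sigma> 1 = 1"
    using ends det' by (simp_all add: \<sigma>_def algebra_simps)
  have mono': "strict_mono_on {0..1} \<sigma>" using mono by (simp add: \<sigma>_def[abs_def])
  have cont': "continuous_on {0..1} \<sigma>"
    unfolding \<sigma>_def by (intro continuous_intros cont)
  have onto: "\<sigma> ` {0..1} = {0..1}"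
    using cont' mono' ends' by (rule strict_mono_on_image_unit_interval)
  \<comment> \<open>\<open>f s\<close> is the parameter at which the path has height
    \<open>s\<close>; it becomes the reparametrization of the straightened loop.\<close>
  obtain f where f: "homeomorphism {0..1} {0..1} \<sigma> f"
    using homeomorphism_compact[OF _ cont' onto strict_mono_on_imp_inj_on[OF mono']] by auto
  have f_in: "f s \<in> {0..1}" and \<sigma>f: "\<sigma> (f s) = s" if "s \<in> {0..1}" for s
    using f that unfolding homeomorphism_def by blast+
  have f\<sigma>: "f (\<sigma> u) = u" if "u \<in> {0..1}" for u
    using f that unfolding homeomorphism_def by blast
  have f01: "f 0 = 0" "f 1 = 1" using f\<sigma>[of 0] f\<sigma>[of 1] ends' by simp_all
  have contf: "continuous_on {0..1} f" using f by (simp add: homeomorphism_def)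
  have monof: "strict_mono_on {0..1} f"
  proof (rule strict_mono_onI)
    fix r s :: real assume rs: "r \<in> {0..1}" "s \<in> {0..1}" "r < s"
    show "f r < f s"
    proof (rule ccontr)
      assume "\<not> f r < f s"
      then have "\<sigma> (f s) \<le> \<sigma> (f r)"
        using strict_mono_on_imp_mono_on[OF mono'] f_in rs by (auto intro: mono_onD)
      then show False using \<sigma>f rs by simp
    qed
  qed
  \<comment> \<open>The second coordinate of the graph over height \<open>s\<close>. It vanishes at
    both ends, hence descends to the circle, where it prescribes the amount of shear.\<close>
  define h where "h s = a * y (f s) - b * x (f s)" for s
  have "f ` {0..1} \<subseteq> {0..1}" using f_in by blast
  then have "continuous_on {0..1} (\<lambda>s. x (f s))" "continuous_on {0..1} (\<lambda>s. y (f s))"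
    using cont contf by (auto intro: continuous_on_compose2)
  then have "continuous_on {0..1} h" unfolding h_def by (intro continuous_intros)
  moreover have "h 0 = h 1" using ends f01 by (simp add: h_def)
  ultimately obtain g where g: "continuous_on (sphere 0 1) g"
    and gh: "\<And>s. s \<in> {0..1} \<Longrightarrow> g (cis (2 * pi * s)) = h s"
    using loop_descends_to_circle by blast
  let ?c = "\<lambda>u. torus_point (x u) (y u)"
  \<comment> \<open>By the determinant, \<open>(x, y) = \<sigma> * (a, b) + h * (c, d)\<close> at
    height \<open>\<sigma>\<close>; the shear at time 1 removes the second summand.\<close>
  have "torus_knot a b s = shiftpath 0 (torus_shear c d g 1 \<circ> ?c) (f s)" if s: "s \<in> {0..1}" for s
  proof -
    have \<sigma>: "d * x (f s) - c * y (f s) = s" using \<sigma>f[OF s] by (simp add: \<sigma>_def)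
    have "x (f s) - h s * c = (a * d - b * c) * x (f s) - h s * c" using det' by simp
    also have "\<dots> = s * a" by (subst (3) \<sigma>[symmetric]) (simp add: h_def algebra_simps)
    finally have 1: "x (f s) - h s * c = s * a" .
    have "y (f s) - h s * d = (a * d - b * c) * y (f s) - h s * d" using det' by simp
    also have "\<dots> = s * b" by (subst (3) \<sigma>[symmetric]) (simp add: h_def algebra_simps)
    finally have 2: "y (f s) - h s * d = s * b" .
    show ?thesis
      using f_in[OF s] 1 2
      by (simp add: shiftpath_def torus_shear_torus_point \<sigma> gh[OF s] torus_knot_def)
  qed
  then have "same_oriented_loop (torus_shear c d g 1 \<circ> ?c) (torus_knot a b)"
    unfolding same_oriented_loop_def using contf monof f01
    by (intro bexI[of _ 0] exI[of _ f]) auto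
  moreover have "simple_loop_on torus (torus_knot a b)"
  proof -
    have "d * (u * a) - c * (u * b) = u" for u :: real
    proof -
      have "d * (u * a) - c * (u * b) = u * (a * d - b * c)" by (simp add: algebra_simps)
      then show ?thesis using det' by simp
    qed
    then have "strict_mono_on {0..1} (\<lambda>u::real. d * (u * a) - c * (u * b))"
      by (simp add: strict_mono_on_def)
    then show ?thesis
      unfolding torus_knot_def[abs_def]
      by (intro simple_loop_on_torus_transverse[OF det]) (auto intro!: continuous_intros)
  qed
  moreover have "simple_loop_on torus ?c"
    by (rule simple_loop_on_torus_transverse[OF assms])
  ultimately show ?thesis
    using ambient_isotopy_torus_shear[OF g] unfolding isotopic_loops_def by blast
qed

text \<open>Transversality of a broken path reduces to one sign per segment: the height grows
  linearly along each.\<close>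

lemma isotopic_loops_torus_two_segments:
  fixes a b c d :: int and x1 y1 x2 y2 :: real
  assumes det: "a * d - b * c = 1"
    and sum: "x1 + x2 = a" "y1 + y2 = b"
    and pos: "d * x1 - c * y1 > 0" "d * x2 - c * y2 > 0"
    and loop: "\<And>u. u \<le> 1/2 \<Longrightarrow> l u = torus_point (2 * u * x1) (2 * u * y1)"
      "\<And>u. u > 1/2 \<Longrightarrow> l u = torus_point (x1 + (2 * u - 1) * x2) (y1 + (2 * u - 1) * y2)"
  shows "isotopic_loops torus l (torus_knot a b)"
proof -
  \<comment> \<open>The clipped parameters \<open>min u (1/2)\<close> and
    \<open>max 0 (u - 1/2)\<close> measure progress along each segment, so one continuous formula
    covers both halves.\<close>
  define x where "x u = 2 * min u (1/2) * x1 + 2 * max 0 (u - 1/2) * x2" for u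
  define y where "y u = 2 * min u (1/2) * y1 + 2 * max 0 (u - 1/2) * y2" for u
  have "l = (\<lambda>u. torus_point (x u) (y u))"
  proof
    fix u
    show "l u = torus_point (x u) (y u)"
      by (cases "u \<le> 1/2") (simp_all add: x_def y_def loop algebra_simps)
  qed
  moreover have "strict_mono_on {0..1} (\<lambda>u. d * x u - c * y u)"
  proof (rule strict_mono_onI)
    fix u v :: real assume "u < v"
    have eq: "d * x u - c * y u =
        2 * min u (1/2) * (d * x1 - c * y1) + 2 * max 0 (u - 1/2) * (d * x2 - c * y2)" for u
      by (simp add: x_def y_def algebra_simps)
    let ?m = "2 * (min v (1/2) - min u (1/2))" and ?n = "2 * (max 0 (v - 1/2) - max 0 (u - 1/2))"
    \<comment> \<open>Starting before the midpoint there is progress on the first segment, otherwise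
      on the second.\<close>
    have "?m > 0 \<and> ?n \<ge> 0 \<or> ?m \<ge> 0 \<and> ?n > 0"
      using \<open>u < v\<close> by (cases "u < 1/2") (auto simp: min_def max_def)
    then have "?m * (d * x1 - c * y1) + ?n * (d * x2 - c * y2) > 0"
      using pos by (meson add_nonneg_pos add_pos_nonneg less_imp_le mult_nonneg_nonneg mult_pos_pos)
    then show "d * x u - c * y u < d * x v - c * y v"
      unfolding eq by (simp only: algebra_simps)
  qed
  ultimately show ?thesis
    using sum by (auto intro!: isotopic_loops_torus_transverse[OF det] continuous_intros
        simp: x_def y_def algebra_simps)
qed


section \<open>The constituent knots\<close>

lemma reversepath_torus_knot: "reversepath (torus_knot a b) = torus_knot (- a) (- b)"
  by (auto simp: reversepath_def torus_knot_def torus_point_eq_iff algebra_simps)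

text \<open>The point of parameter \<open>j / p\<close> lifts to \<open>(j, k + 1 / p)\<close>,
  which lies over \<open>meridian (1 / p)\<close>. A parameter strictly between 0 and 1 is
  determined by its point on the knot.\<close>

lemma meeting_knot_eq:
  fixes p q j k :: int
  assumes pq: "coprime p q" "p \<ge> 2" and j: "1 \<le> j" "j \<le> p - 1" and jk: "j * q - k * p = 1"
  shows "meeting_knot p q = j / p"
proof -
  have p: "real_of_int p > 0" using pq by simp
  have "real_of_int j * q - k * p = 1" using jk by (metis of_int_1 of_int_diff of_int_mult)
  then have "j / p * q - 1 / p = k" using p by (simp add: field_simps)
  then have "torus_knot p q (j / p) = meridian (1 / p)"
    using p by (simp add: torus_knot_def meridian_def torus_point_eq_iff)
  then have "torus_knot p q (meeting_knot p q) = torus_knot p q (j / p)"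
    using meeting_knot(2)[OF pq] by (simp add: meeting_meridian_eq[OF pq])
  then have "meeting_knot p q - j / p \<in> \<int>" using torus_knot_eq_iff[OF pq(1)] by blast
  moreover have "\<bar>meeting_knot p q - j / p\<bar> < 1"
  proof -
    have "0 < j / p" "j / p < 1" using p j by simp_all
    then show ?thesis using meeting_knot(1)[OF pq] by auto
  qed
  ultimately show ?thesis using Ints_nonzero_abs_less1 by fastforce
qed

text \<open>Used to name the lattice vector \<open>(m, n)\<close> by which the lift of an edge is
  translated.\<close>

lemma torus_point_eqI:
  assumes "s = s' + of_int m" and "t = t' + of_int n"
  shows "torus_point s t = torus_point s' t'"
  using assms by (simp add: torus_point_eq_iff)

text \<open>Edge 1 lifts to displacement \<open>(j, k + r)\<close>, edge 2 to
  \<open>- (1 - w) * (p, q)\<close> and edge 3 to \<open>(0, r)\<close>. Each constituent uses two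
  of these vectors up to sign, with heights \<open>w\<close> and \<open>1 - w\<close> in some
  order.\<close>

lemma constituents_pos_torus_theta:
  fixes p q j k :: int
  assumes pq: "coprime p q" "p \<ge> 2" and j: "1 \<le> j" "j \<le> p - 1" and jk: "j * q - k * p = 1"
  shows "isotopic_loops torus (constituent3 (pos_torus_theta p q)) (torus_knot p q)"
    and "isotopic_loops torus (constituent2 (pos_torus_theta p q)) (reversepath (torus_knot j k))"
    and "isotopic_loops torus (constituent1 (pos_torus_theta p q))
           (reversepath (torus_knot (p - j) (q - k)))"
proof -
  define w where "w = real_of_int j / p"
  define r where "r = 1 / real_of_int p"
  note defs = constituent1_def constituent2_def constituent3_def joinpaths_def reversepath_def
    subpath_def pos_torus_theta_def meeting_knot_eq[OF assms, folded w_def]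
    meeting_meridian_eq[OF pq, folded r_def] torus_knot_def meridian_def
  have p: "real_of_int p > 0" using pq by simp
  have w: "0 < w" "0 < 1 - w" and wp: "w * p = j" and jr: "j * r = w" and pr: "p * r = 1"
    using p j by (simp_all add: w_def r_def)
  have rjk: "real_of_int j * q - k * p = 1"
    using jk by (metis of_int_1 of_int_diff of_int_mult)
  then have wq: "w * q = k + r"
    using p by (simp add: w_def r_def field_simps)
  have jw: "real_of_int j = w * p" and kw: "real_of_int k = w * q - r"
    using wp wq by simp_all
  \<comment> \<open>With transverse direction \<open>- (j, k)\<close> the vector
    \<open>t * (p, q)\<close> has height \<open>t\<close>.\<close>
  show "isotopic_loops torus (constituent3 (pos_torus_theta p q)) (torus_knot p q)"
  proof (rule isotopic_loops_torus_two_segments[where c = "- j" and d = "- k" and ?x1.0 = "w * p"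
        and ?y1.0 = "w * q" and ?x2.0 = "(1 - w) * p" and ?y2.0 = "(1 - w) * q"])
    show "p * - k - q * - j = 1" using jk by (simp add: algebra_simps)
    have *: "real_of_int (- k) * (t * p) - real_of_int (- j) * (t * q) = t" for t :: real
    proof -
      have "real_of_int (- k) * (t * p) - real_of_int (- j) * (t * q) = t * (j * q - k * p)"
        by (simp add: algebra_simps)
      then show ?thesis using rjk by simp
    qed
    show "0 < real_of_int (- k) * (w * p) - real_of_int (- j) * (w * q)"
      "0 < real_of_int (- k) * ((1 - w) * p) - real_of_int (- j) * ((1 - w) * q)"
      unfolding * using w by simp_all
  qed (auto simp: defs algebra_simps)
  \<comment> \<open>With transverse direction \<open>- (p - j, q - k)\<close> edge 3 gains height
    \<open>(p - j) * r = 1 - w\<close> and reversed edge 1 gains \<open>w\<close>.\<close>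
  show "isotopic_loops torus (constituent2 (pos_torus_theta p q)) (reversepath (torus_knot j k))"
    unfolding reversepath_torus_knot
  proof (rule isotopic_loops_torus_two_segments[where c = "- (p - j)" and d = "- (q - k)"
        and ?x1.0 = 0 and ?y1.0 = r and ?x2.0 = "- (w * p)" and ?y2.0 = "- (w * q)"])
    show "- j * - (q - k) - - k * - (p - j) = 1" using jk by (simp add: algebra_simps)
    show "0 + - (w * p) = real_of_int (- j)" "r + - (w * q) = real_of_int (- k)"
      using wp wq by simp_all
    show "0 < real_of_int (- (q - k)) * 0 - real_of_int (- (p - j)) * r"
      using w pr jr by (simp add: algebra_simps)
    have "real_of_int (- (q - k)) * (- (w * p)) - real_of_int (- (p - j)) * (- (w * q)) =
        w * (j * q - k * p)"
      by (simp add: algebra_simps)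
    then show "0 < real_of_int (- (q - k)) * (- (w * p)) - real_of_int (- (p - j)) * (- (w * q))"
      using w rjk by simp
    fix u :: real
    show "constituent2 (pos_torus_theta p q) u = torus_point (2 * u * 0) (2 * u * r)" if "u \<le> 1/2"
      using that by (simp add: defs algebra_simps)
    show "constituent2 (pos_torus_theta p q) u =
        torus_point (0 + (2 * u - 1) * - (w * p)) (r + (2 * u - 1) * - (w * q))" if "u > 1/2"
    proof -
      \<comment> \<open>Reversed edge 1 lifts to a segment starting at \<open>(j, k + r)\<close>;
        translation by \<open>- (j, k)\<close> attaches it to the end \<open>(0, r)\<close> of edge
        3.\<close>
      have "constituent2 (pos_torus_theta p q) u =
          torus_point (w * (1 - (2 * u - 1)) * p) (w * (1 - (2 * u - 1)) * q)"
        using that by (simp add: defs)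
      also have "\<dots> = torus_point (0 + (2 * u - 1) * - (w * p)) (r + (2 * u - 1) * - (w * q))"
        by (intro torus_point_eqI[of _ _ j _ _ k]) (simp_all add: jw kw algebra_simps)
      finally show ?thesis .
    qed
  qed
  \<comment> \<open>With transverse direction \<open>(j, k)\<close> edge 2 gains height
    \<open>1 - w\<close> and reversed edge 3 gains \<open>j * r = w\<close>.\<close>
  show "isotopic_loops torus (constituent1 (pos_torus_theta p q))
           (reversepath (torus_knot (p - j) (q - k)))"
    unfolding reversepath_torus_knot
  proof (rule isotopic_loops_torus_two_segments[where c = j and d = k
        and ?x1.0 = "- (1 - w) * p" and ?y1.0 = "- (1 - w) * q" and ?x2.0 = 0 and ?y2.0 = "- r"])
    show "- (p - j) * k - - (q - k) * j = 1" using jk by (simp add: algebra_simps)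
    show "- (1 - w) * p + 0 = real_of_int (- (p - j))" "- (1 - w) * q + - r = real_of_int (- (q - k))"
      using wp wq by (simp_all add: algebra_simps)
    show "0 < real_of_int k * 0 - real_of_int j * - r"
      using w jr by simp
    have "real_of_int k * (- (1 - w) * p) - real_of_int j * (- (1 - w) * q) =
        (1 - w) * (j * q - k * p)"
      by (simp add: algebra_simps)
    then show "0 < real_of_int k * (- (1 - w) * p) - real_of_int j * (- (1 - w) * q)"
      using w rjk by simp
    fix u :: real
    \<comment> \<open>Edge 2 descends the lifted knot from \<open>(p, q)\<close>, which is
      translated to the origin.\<close>
    show "constituent1 (pos_torus_theta p q) u =
        torus_point (2 * u * (- (1 - w) * p)) (2 * u * (- (1 - w) * q))" if "u \<le> 1/2"
      using that by (simp add: defs) (rule torus_point_eqI[of _ _ p _ _ q]; simp add: algebra_simps)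
    show "constituent1 (pos_torus_theta p q) u =
        torus_point (- (1 - w) * p + (2 * u - 1) * 0) (- (1 - w) * q + (2 * u - 1) * - r)" if "u > 1/2"
    proof -
      \<comment> \<open>Reversed edge 3 descends from \<open>(0, r)\<close>; translation by
        \<open>- (p - j, q - k)\<close> moves this start to the end of the first segment.\<close>
      have "constituent1 (pos_torus_theta p q) u = torus_point 0 (r * (1 - (2 * u - 1)))"
        using that by (simp add: defs)
      also have "\<dots> =
          torus_point (- (1 - w) * p + (2 * u - 1) * 0) (- (1 - w) * q + (2 * u - 1) * - r)"
        by (intro torus_point_eqI[of _ _ "p - j" _ _ "q - k"]) (simp_all add: jw kw algebra_simps)
      finally show ?thesis .
    qed
  qed
qed

section \<open>Images under the symmetries \<open>mirror\<close> and \<open>rho\<close>\<close>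

lemma constituent_theta_image:
  "constituent1 (theta_image f \<Theta>) = f \<circ> constituent1 \<Theta>"
  "constituent2 (theta_image f \<Theta>) = f \<circ> constituent2 \<Theta>"
  "constituent3 (theta_image f \<Theta>) = f \<circ> constituent3 \<Theta>"
  by (auto simp: constituent1_def constituent2_def constituent3_def theta_image_def
      joinpaths_def reversepath_def)

text \<open>Conjugation by \<open>f\<close> transports each isotopy of point sets, so the image
  curves need no new geometry.\<close>

lemma unoriented_constituents_theta_image:
  assumes iso: "isotopic_sets torus (path_image (constituent1 \<Theta>)) (path_image c1)"
      "isotopic_sets torus (path_image (constituent2 \<Theta>)) (path_image c2)"
      "isotopic_sets torus (path_image (constituent3 \<Theta>)) (path_image c3)"
    and f: "continuous_on torus f" "\<And>x. x \<in> torus \<Longrightarrow> f x \<in> torus" "\<And>x. x \<in> torus \<Longrightarrow> f (f x) = x"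
  shows "unoriented_constituents torus (theta_image f \<Theta>) =
    unoriented_class torus ` {f \<circ> c3, f \<circ> c2, f \<circ> c1}"
proof -
  have "unoriented_class torus (f \<circ> c) = unoriented_class torus (f \<circ> d)"
    if "isotopic_sets torus (path_image c) (path_image d)" for c d
    using isotopic_sets_involution[OF that f]
    by (intro unoriented_class_eqI compact_torus) (simp add: path_image_compose)
  then show ?thesis
    using iso by (simp add: unoriented_constituents_def constituent_theta_image insert_commute)
qed

lemma conjugations_of_torus:
  shows "continuous_on torus mirror" "z \<in> torus \<Longrightarrow> mirror z \<in> torus" "mirror (mirror z) = z"
    and "continuous_on torus rho" "z \<in> torus \<Longrightarrow> rho z \<in> torus" "rho (rho z) = z"
    and "mirror (rho z) = rho (mirror z)"
  by (auto simp: mirror_def[abs_def] rho_def[abs_def] torus_def norm_prod_def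
      intro!: continuous_intros)

lemma mirror_torus_knot: "mirror \<circ> torus_knot a b = torus_knot a (- b)"
  and rho_torus_knot: "rho \<circ> torus_knot a b = torus_knot (- a) (- b)"
  by (auto simp: mirror_def rho_def torus_knot_def torus_point_def cis_cnj)

lemma theta_image_theta_image: "theta_image f (theta_image g \<Theta>) = theta_image (f \<circ> g) \<Theta>"
  by (simp add: theta_image_def o_assoc)

theorem proposition4p1:
  fixes p q j k :: int
  assumes "coprime p q" and "p \<ge> 2" and "q \<ge> 2"
    and "[j * q = 1] (mod p)" and "1 \<le> j" and "j \<le> p - 1"
    and "[k * (- p) = 1] (mod q)" and "1 \<le> k" and "k \<le> q - 1"
  shows
    "isotopic_loops torus (constituent3 (torus_theta p q)) (torus_knot p q) \<and>
     isotopic_loops torus (constituent2 (torus_theta p q)) (reversepath (torus_knot j k)) \<and>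
     isotopic_loops torus (constituent1 (torus_theta p q))
       (reversepath (torus_knot (p - j) (q - k))) \<and>
     unoriented_constituents torus (torus_theta p q) =
       unoriented_class torus ` {torus_knot p q, torus_knot j k, torus_knot (p - j) (q - k)} \<and>
     1 \<le> p - j \<and> p - j \<le> p - 1 \<and> 1 \<le> q - k \<and> q - k \<le> q - 1 \<and>
     unoriented_constituents torus (torus_theta p (- q)) =
       unoriented_class torus `
         {torus_knot p (- q), torus_knot j (- k), torus_knot (p - j) (k - q)} \<and>
     unoriented_constituents torus (torus_theta (- p) (- q)) =
       unoriented_class torus `
         {torus_knot (- p) (- q), torus_knot (- j) (- k), torus_knot (j - p) (k - q)} \<and>
     unoriented_constituents torus (torus_theta (- p) q) =
       unoriented_class torus `
         {torus_knot (- p) q, torus_knot (- j) k, torus_knot (j - p) (q - k)} \<and>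
     1 - p \<le> - j \<and> - j \<le> -1 \<and> 1 - q \<le> - k \<and> - k \<le> -1 \<and>
     1 - p \<le> j - p \<and> j - p \<le> -1 \<and> 1 - q \<le> k - q \<and> k - q \<le> -1"
proof -
  have pos: "p > 0" "q > 0" using assms by auto
  have "p dvd j * q - 1" using assms(4) by (simp add: cong_iff_dvd_diff)
  \<comment> \<open>Once \<open>k'\<close> is identified with \<open>k\<close>, the two modular
    inverses are tied together by a single determinant equation.\<close>
  then obtain k' where k': "j * q - 1 = p * k'" by (elim dvdE)
  \<comment> \<open>Modulo \<open>q\<close> both \<open>- k * p\<close> and \<open>- k' * p\<close>
    are 1, and \<open>p\<close> is cancellable by coprimality.\<close>
  have "[k = k'] (mod q)"
  proof -
    have "q dvd k * (- p) - 1" using assms(7) by (simp add: cong_iff_dvd_diff)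
    moreover have "(k - k') * p = - (k * (- p) - 1) - j * q"
      using k' by (simp add: algebra_simps)
    ultimately have "q dvd (k - k') * p" by (simp only: dvd_diff dvd_minus_iff dvd_triv_right)
    then show ?thesis
      using assms(1) by (simp add: cong_iff_dvd_diff coprime_dvd_mult_left_iff coprime_commute)
  qed
  \<comment> \<open>The bounds \<open>1 \<le> j * q < p * q\<close> make \<open>k'\<close> a reduced
    residue modulo \<open>q\<close>, as \<open>k\<close> is.\<close>
  moreover have "0 \<le> k' \<and> k' < q"
  proof -
    have "j * q \<ge> 1 * 1" using assms by (intro mult_mono) auto
    then have "p * k' \<ge> 0" using k' by simp
    moreover have "j * q < p * q" using assms by (intro mult_strict_right_mono) auto
    then have "p * k' < p * q" using k' by simp
    ultimately show ?thesis using pos by (simp add: zero_le_mult_iff)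
  qed
  ultimately have "k = k'" using assms(8,9) by (simp add: cong_def)
  then have jk: "j * q - k * p = 1" using k' by (simp add: algebra_simps)
  let ?\<Theta> = "pos_torus_theta p q"
  note iso = constituents_pos_torus_theta[OF assms(1,2,5,6) jk]
  \<comment> \<open>On point sets the reversals of orientation disappear.\<close>
  note sets = iso[THEN isotopic_loops_imp_isotopic_sets, simplified path_image_reversepath]
  note im = unoriented_constituents_theta_image[OF sets(3,2,1)]
  \<comment> \<open>The unreflected curve is the case of the identity as involution.\<close>
  have "unoriented_constituents torus ?\<Theta> =
      unoriented_class torus ` {torus_knot p q, torus_knot j k, torus_knot (p - j) (q - k)}"
    using im[of "\<lambda>z. z"] by (simp add: theta_image_def o_def)
  moreover have "unoriented_constituents torus (theta_image mirror ?\<Theta>) =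
      unoriented_class torus `
        {torus_knot p (- q), torus_knot j (- k), torus_knot (p - j) (k - q)}"
    using im[OF conjugations_of_torus(1-3)] by (simp add: mirror_torus_knot)
  moreover have "unoriented_constituents torus (theta_image rho ?\<Theta>) =
      unoriented_class torus `
        {torus_knot (- p) (- q), torus_knot (- j) (- k), torus_knot (j - p) (k - q)}"
    using im[OF conjugations_of_torus(4-6)] by (simp add: rho_torus_knot)
  moreover have "unoriented_constituents torus (theta_image mirror (theta_image rho ?\<Theta>)) =
      unoriented_class torus `
        {torus_knot (- p) q, torus_knot (- j) k, torus_knot (j - p) (q - k)}"
  proof -
    \<comment> \<open>As \<open>mirror\<close> and \<open>rho\<close> commute, their composite is
      again an involution of the torus.\<close>
    have "continuous_on torus (mirror \<circ> rho)"
      using conjugations_of_torus by (intro continuous_on_compose) (auto intro: continuous_on_subset)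
    then show ?thesis
      using im[of "mirror \<circ> rho"]
      by (simp add: conjugations_of_torus theta_image_theta_image comp_assoc rho_torus_knot
          mirror_torus_knot)
  qed
  moreover have "torus_theta p q = ?\<Theta>" "torus_theta p (- q) = theta_image mirror ?\<Theta>"
    "torus_theta (- p) (- q) = theta_image rho ?\<Theta>"
    "torus_theta (- p) q = theta_image mirror (theta_image rho ?\<Theta>)"
    using pos by (simp_all add: torus_theta_def)
  ultimately show ?thesis
    using iso assms(2,3,5,6,8,9) by simp
qed

end
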